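(* Let $S_{[1]},S_{[2]},\dots,S_{[t]}\in\mathcal S$ be distinct sets and let $\delta_{[i]}$ denote the $\delta$ variable associated with $S_{[i]}$. Let $S'\subseteq J$. Then the inequality $$\sum_{j\in S'}z_j+\bigl(u-|S'\setminus S_{[1]}|\bigr)\delta_{[1]}+\sum_{i=2}^t\Bigl|\bigl(S'\cap S_{[i]}\bigr)\setminus\bigcup_{k=1}^{i-1}S_{[k]}\Bigr|\,\delta_{[i]}\ \le\ u$$ is valid for $\operatorname{conv}(X^{l,u})$, provided that $\max_{i=2,\dots,t}|S'\setminus(S_{[1]}\cap S_{[i]})|\le u$.
   Context: Let $n,m$ be positive integers, $J=\{1,\dots,n\}$, $I=\{1,\dots,m\}$, and let $l,u$ be integers with $0\le l\le u$ and $u\ge2$. Let $S_1,\dots,S_m$ be distinct subsets of $J$ with $1\le|S_i|\le n-l$ for all $i\in I$ (not necessarily nested), and $\mathcal S=\{S_i\}_{i\in I}$. Define $$X^{l,u}=\Bigl\{(z,\delta)\in\{0,1\}^n\times\{0,1\}^m:\ \delta_i=\prod_{j\in S_i}(1-z_j)\ (i\in I),\ l\le\sum_{j\in J}z_j\le u\Bigr\}.$$ *)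

theory Defs
  imports "HOL-Analysis.Analysis"
begin

text \<open>
  The index sets \<open>J\<close> and \<open>I\<close> are the universes of the finite types \<open>'n\<close> and \<open>'m\<close>, so that
  \<open>n = CARD('n)\<close> and \<open>m = CARD('m)\<close> are arbitrary positive integers and \<open>(z, \<delta>)\<close> is a point of
  the real vector space \<open>(real^'n) \<times> (real^'m)\<close>, in which \<open>convex hull\<close> is taken.
\<close>

definition X_set :: "('m \<Rightarrow> 'n set) \<Rightarrow> int \<Rightarrow> int \<Rightarrow> ((real^'n::finite) \<times> (real^'m::finite)) set" where
  "X_set S l u = {(z, \<delta>).
     (\<forall>j. z $ j \<in> {0, 1}) \<and>
     (\<forall>i. \<delta> $ i \<in> {0, 1}) \<and>
     (\<forall>i. \<delta> $ i = (\<Prod>j\<in>S i. 1 - z $ j)) \<and>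
     real_of_int l \<le> (\<Sum>j\<in>UNIV. z $ j) \<and>
     (\<Sum>j\<in>UNIV. z $ j) \<le> real_of_int u}"

end

theory Submission
  imports Defs
begin

text \<open>
  The left-hand side is linear in \<open>(z, \<delta>)\<close>, so it suffices to bound it on \<open>X_set S l u\<close> itself
  (\<open>convex_hull_linear_bound\<close>). At a point of that set, \<open>z\<close> is the indicator of a set \<open>Z\<close> with at
  most \<open>u\<close> elements, and \<open>\<delta> $ i = 1\<close> exactly when \<open>Z\<close> misses \<open>S i\<close>. Call \<open>\<sigma> i\<close> active if \<open>Z\<close>
  misses \<open>S (\<sigma> i)\<close>, and for \<open>i \<ge> 2\<close> let \<open>D i\<close> be the part of \<open>S' \<inter> S (\<sigma> i)\<close> that no earlier
  set \<open>S (\<sigma> k)\<close> covers. The set \<open>Z \<inter> S'\<close> and the sets \<open>D i\<close> with \<open>\<sigma> i\<close> active are pairwise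
  disjoint, so their sizes add up to at most the size of any set containing all of them
  (\<open>card_first_cover_le\<close>). It remains to choose that container.

  If \<open>\<sigma> 1\<close> is active, then \<open>Z\<close> misses \<open>S (\<sigma> 1)\<close>, as does every \<open>D i\<close>, so \<open>S' - S (\<sigma> 1)\<close>
  is a container, and its size is just what the coefficient of \<open>\<delta> $ \<sigma> 1\<close> leaves of \<open>u\<close>. If \<open>\<sigma> 1\<close>
  is inactive but some \<open>\<sigma> i\<close> with \<open>i \<ge> 2\<close> is active, then \<open>Z\<close> misses \<open>S (\<sigma> i)\<close> and every \<open>D k\<close>
  misses \<open>S (\<sigma> 1)\<close>, so \<open>S' - (S (\<sigma> 1) \<inter> S (\<sigma> i))\<close> is a container, of size at most \<open>u\<close> by the
  hypothesis on the maximum. If nothing is active, only \<open>card (Z \<inter> S') \<le> u\<close> is left.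
\<close>

lemma convex_hull_linear_bound:
  fixes f :: "'a::real_vector \<Rightarrow> real"
  assumes "linear f" and "\<And>x. x \<in> X \<Longrightarrow> f x \<le> c" and "x \<in> convex hull X"
  shows "f x \<le> c"
proof -
  have "convex (f -` {..c})"
    using assms(1) by (intro convex_linear_vimage) auto
  then have "convex hull X \<subseteq> f -` {..c}"
    using assms(2) by (intro hull_minimal) auto
  with assms(3) show ?thesis by auto
qed

text \<open>
  Removing the earlier sets makes the pieces disjoint, and pieces coming from sets that \<open>Z\<close> misses
  are disjoint from \<open>Z\<close>. The container \<open>C\<close> is left free because the two cases in which some index is
  active use different ones. The unions start at \<open>k = 1\<close>, so they would not remove \<open>T 0\<close>; this is
  why \<open>0\<close> is kept out of \<open>A\<close>.
\<close>

lemma card_first_cover_le: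
  fixes T :: "nat \<Rightarrow> 'a set"
  assumes "finite C" and "finite A" and "0 \<notin> A"
    and miss: "\<And>i. i \<in> A \<Longrightarrow> Z \<inter> T i = {}"
    and Z: "Z \<inter> R \<subseteq> C"
    and D: "\<And>i. i \<in> A \<Longrightarrow> R \<inter> T i - (\<Union>k\<in>{1..i - 1}. T k) \<subseteq> C"
  shows "card (Z \<inter> R) + (\<Sum>i\<in>A. card (R \<inter> T i - (\<Union>k\<in>{1..i - 1}. T k))) \<le> card C"
proof -
  define D where "D i = R \<inter> T i - (\<Union>k\<in>{1..i - 1}. T k)" for i
  have fin: "finite (Z \<inter> R)" "\<And>i. i \<in> A \<Longrightarrow> finite (D i)"
    unfolding D_def using finite_subset[OF _ \<open>finite C\<close>] Z D by blast+
  have less: "D i \<inter> D j = {}" if "i \<in> A" "i < j" for i j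
  proof -
    have "i \<in> {1..j - 1}"
      using that \<open>0 \<notin> A\<close> by (cases i) auto
    then show ?thesis by (auto simp: D_def)
  qed
  have disj: "D i \<inter> D j = {}" if "i \<in> A" "j \<in> A" "i \<noteq> j" for i j
    using less[of i j] less[of j i] that by (cases i j rule: linorder_cases) auto
  have "(\<Sum>i\<in>A. card (D i)) = card (\<Union>i\<in>A. D i)"
    using assms(2) fin disj by (intro card_UN_disjoint[symmetric]) auto
  moreover have "card (Z \<inter> R) + card (\<Union>i\<in>A. D i) = card ((Z \<inter> R) \<union> (\<Union>i\<in>A. D i))"
    using assms(2) fin miss by (intro card_Un_disjoint[symmetric]) (auto simp: D_def)
  moreover have "card ((Z \<inter> R) \<union> (\<Union>i\<in>A. D i)) \<le> card C"
    using assms(1) Z D by (intro card_mono) (auto simp: D_def)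
  ultimately show ?thesis by (simp add: D_def)
qed

lemma sum_binary_eq_card:
  fixes z :: "'a \<Rightarrow> real"
  assumes "finite A" and "\<And>j. z j \<in> {0, 1}"
  shows "(\<Sum>j\<in>A. z j) = real (card ({j. z j = 1} \<inter> A))"
proof -
  have "(\<Sum>j\<in>A. z j) = (\<Sum>j\<in>A. if j \<in> {j. z j = 1} then 1 else 0)"
    using assms(2) by (intro sum.cong) auto
  also have "\<dots> = real (card ({j. z j = 1} \<inter> A))"
    using assms(1) by (simp add: sum.If_cases Int_commute Collect_conj_eq)
  finally show ?thesis .
qed

lemma prod_one_minus_binary:
  fixes z :: "'a \<Rightarrow> real"
  assumes "finite A" and "\<And>j. z j \<in> {0, 1}"
  shows "(\<Prod>j\<in>A. 1 - z j) = (if {j. z j = 1} \<inter> A = {} then 1 else 0)"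
proof (cases "{j. z j = 1} \<inter> A = {}")
  case True
  then have "\<forall>j\<in>A. z j = 0" using assms(2) by fastforce
  then show ?thesis using True by simp
next
  case False
  then have "\<exists>j\<in>A. 1 - z j = 0" by auto
  then show ?thesis using assms(1) False by auto
qed

text \<open>
  The combinatorial content of the inequality, at the 0/1 point with support \<open>Z\<close>. Here \<open>T i\<close> stands
  for \<open>S (\<sigma> i)\<close>, and the bracketed conditions are the values of the \<open>\<delta>\<close> variables.
\<close>

lemma first_cover_inequality:
  fixes T :: "nat \<Rightarrow> 'a::finite set" and u :: real
  assumes Zu: "real (card Z) \<le> u"
    and pair: "\<And>i. i \<in> {2..t} \<Longrightarrow> real (card (R - (T 1 \<inter> T i))) \<le> u"
  shows "real (card (Z \<inter> R))
    + (u - real (card (R - T 1))) * of_bool (Z \<inter> T 1 = {})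
    + (\<Sum>i=2..t. real (card (R \<inter> T i - (\<Union>k\<in>{1..i - 1}. T k))) * of_bool (Z \<inter> T i = {})) \<le> u"
proof -
  define A where "A = {i \<in> {2..t}. Z \<inter> T i = {}}"
  define D where "D i = R \<inter> T i - (\<Union>k\<in>{1..i - 1}. T k)" for i
  have active: "(\<Sum>i=2..t. real (card (D i)) * of_bool (Z \<inter> T i = {})) = real (\<Sum>i\<in>A. card (D i))"
    by (simp add: A_def sum.inter_filter[symmetric] of_bool_def if_distrib cong: if_cong)
  have D1: "D i \<subseteq> R - T 1" if "i \<in> A" for i
    using that by (force simp: A_def D_def)
  have pack: "card (Z \<inter> R) + (\<Sum>i\<in>A. card (D i)) \<le> card C"
    if "Z \<inter> R \<subseteq> C" "R - T 1 \<subseteq> C \<or> A = {}" for C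
    unfolding D_def using that D1 by (intro card_first_cover_le) (auto simp: A_def D_def)
  consider "Z \<inter> T 1 = {}" | i where "Z \<inter> T 1 \<noteq> {}" "i \<in> A" | "Z \<inter> T 1 \<noteq> {}" "A = {}"
    by blast
  then have "real (card (Z \<inter> R)) + (u - real (card (R - T 1))) * of_bool (Z \<inter> T 1 = {})
      + real (\<Sum>i\<in>A. card (D i)) \<le> u"
  proof cases
    case 1
    then have "card (Z \<inter> R) + (\<Sum>i\<in>A. card (D i)) \<le> card (R - T 1)"
      by (intro pack) auto
    then have "real (card (Z \<inter> R) + (\<Sum>i\<in>A. card (D i))) \<le> real (card (R - T 1))"
      by (rule of_nat_mono)
    with 1 show ?thesis by simp
  next
    case 2
    then have "card (Z \<inter> R) + (\<Sum>i\<in>A. card (D i)) \<le> card (R - (T 1 \<inter> T i))"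
      by (intro pack) (auto simp: A_def)
    then have "real (card (Z \<inter> R) + (\<Sum>i\<in>A. card (D i))) \<le> real (card (R - (T 1 \<inter> T i)))"
      by (rule of_nat_mono)
    moreover have "real (card (R - (T 1 \<inter> T i))) \<le> u"
      using 2 by (intro pair) (auto simp: A_def)
    ultimately show ?thesis using 2 by simp
  next
    case 3
    then have "card (Z \<inter> R) + (\<Sum>i\<in>A. card (D i)) \<le> card Z"
      by (intro pack) auto
    with 3 Zu show ?thesis by simp
  qed
  with active show ?thesis by (simp add: D_def)
qed

theorem proposition20:
  fixes S :: "'m::finite \<Rightarrow> 'n::finite set"
    and l u :: int
    and t :: nat
    and \<sigma> :: "nat \<Rightarrow> 'm"
    and S' :: "'n set"
  assumes "0 \<le> l" and "l \<le> u" and "2 \<le> u"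
    and "inj S"
    and "\<And>i. 1 \<le> card (S i)"
    and "\<And>i. int (card (S i)) \<le> int CARD('n) - l"
    and "1 \<le> t"
    and "inj_on (\<lambda>i. S (\<sigma> i)) {1..t}"
    and "2 \<le> t \<Longrightarrow> (MAX i\<in>{2..t}. int (card (S' - (S (\<sigma> 1) \<inter> S (\<sigma> i))))) \<le> u"
  shows "\<forall>(z, \<delta>) \<in> convex hull (X_set S l u).
    (\<Sum>j\<in>S'. z $ j)
    + (real_of_int u - real (card (S' - S (\<sigma> 1)))) * \<delta> $ \<sigma> 1
    + (\<Sum>i=2..t. real (card ((S' \<inter> S (\<sigma> i)) - (\<Union>k\<in>{1..i - 1}. S (\<sigma> k)))) * \<delta> $ \<sigma> i)
    \<le> real_of_int u"
proof -
  define a where "a = real_of_int u - real (card (S' - S (\<sigma> 1)))"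
  define d where "d i = real (card ((S' \<inter> S (\<sigma> i)) - (\<Union>k\<in>{1..i - 1}. S (\<sigma> k))))" for i
  define f :: "(real^'n) \<times> (real^'m) \<Rightarrow> real" where
    "f p = (\<Sum>j\<in>S'. fst p $ j) + a * snd p $ \<sigma> 1 + (\<Sum>i=2..t. d i * snd p $ \<sigma> i)" for p
  have "linear f"
    by (rule linearI)
      (simp_all add: f_def sum.distrib sum_distrib_left algebra_simps)
  have pair: "real (card (S' - (S (\<sigma> 1) \<inter> S (\<sigma> i)))) \<le> real_of_int u" if "i \<in> {2..t}" for i
  proof -
    have "int (card (S' - (S (\<sigma> 1) \<inter> S (\<sigma> i))))
        \<le> (MAX i\<in>{2..t}. int (card (S' - (S (\<sigma> 1) \<inter> S (\<sigma> i)))))"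
      using that by (intro Max_ge) auto
    also have "\<dots> \<le> u"
      using that assms(9) by simp
    finally show ?thesis by linarith
  qed
  have vertex: "f p \<le> real_of_int u" if "p \<in> X_set S l u" for p
  proof -
    obtain z \<delta> where p: "p = (z, \<delta>)" by (cases p)
    define Z where "Z = {j. z $ j = 1}"
    have z: "z $ j \<in> {0, 1}" for j
      using that by (auto simp: p X_set_def)
    have delta: "\<delta> $ i = of_bool (Z \<inter> S i = {})" for i
      using that prod_one_minus_binary[of "S i" "\<lambda>j. z $ j"] z
      by (auto simp: p X_set_def Z_def)
    have sumz: "(\<Sum>j\<in>A. z $ j) = real (card (Z \<inter> A))" for A
      unfolding Z_def using z by (intro sum_binary_eq_card) auto
    have "real (card Z) \<le> real_of_int u"
      using that sumz[of UNIV] by (auto simp: p X_set_def)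
    from first_cover_inequality[where T = "\<lambda>i. S (\<sigma> i)" and R = S', OF this pair]
    show ?thesis
      by (simp add: f_def p a_def d_def delta sumz)
  qed
  have "f p \<le> real_of_int u" if "p \<in> convex hull (X_set S l u)" for p
    using convex_hull_linear_bound[OF \<open>linear f\<close> vertex that] .
  then show ?thesis
    by (auto simp: f_def a_def d_def)
qed

end
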